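(* Let $0<\alpha,\beta<1$. The following models are not in $\mathcal Q$, due to lattice incompatibility: Cole–Cole: $G^*(\omega)=G_\infty+\dfrac{\Delta G}{1+(i\omega\tau)^{-\alpha}}$; Havriliak–Negami: $G^*(\omega)=G_\infty+\dfrac{\Delta G}{[1+(i\omega\tau)^{\alpha}]^{\beta}}$; Fractional Zener: $G^*(\omega)=G_e\,\dfrac{1+(i\omega\tau)^\alpha}{1+\delta(i\omega\tau)^\alpha}$ with $\delta=G_e/G_\infty<1$.
   Context: Here $\omega>0$, $\tau>0$ is a relaxation time, $\Delta G=G_0-G_\infty$, and $G_e$ is the equilibrium modulus. A model is in $\mathcal Q$ if its complex modulus is represented by a relaxation spectrum $H(\tau)$ whose Mellin transform $\tilde H$ lies in $\mathcal Q$, i.e. there is a (non-trivial) solution $\tilde H\in\mathcal Q$ of the constitutive equation $\tilde G(s)=\tilde K(s)\tilde H(-s)$, $\tilde K(s)=\pi e^{i\pi(1-s)/2}\csc(\pi s)$, where $\tilde G$ is the Mellin transform in $\omega$ of $G^*(\omega)-G_\infty$ (this equation is the Mellin form of $G^*(\omega)=G_\infty+\int_0^\infty\frac{i\omega\tau}{1+i\omega\tau}H(\tau)\frac{d\tau}{\tau}$). The Mellin transform is $\tilde f(s)=\int_0^\infty t^{s-1}f(t)\,dt$, extended by analytic continuation and to distributions. Class $\mathcal H$: functions $\prod_{i=1}^N\Gamma(a_is+b_i)\big/\prod_{j=1}^M\Gamma(c_js+d_j)$ with $a_i,c_j>0$, $N,M<\infty$. Extended Fox class $\mathcal Q$: functions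 $\tilde H(s)=H_\Gamma(s)Q(s)$ with $H_\Gamma\in\mathcal H$ and $Q(s)=\exp(P(s))$, $P$ entire. Lattice compatibility refers to the alignment of the arithmetic pole lattice $\Lambda_G$ of the Gamma factors of $\tilde G$ with the integer lattice (poles of $\tilde K$) and the pole lattice $\Lambda_H$ of $\tilde H$: $\Lambda_G\subseteq\mathbb Z\cup(-\Lambda_H)$ and $\Lambda_H\subseteq\mathbb Z\cup(-\Lambda_G)$. *)

theory Defs
  imports "HOL-Complex_Analysis.Complex_Analysis"
begin

definition mellin_integrand :: "(real \<Rightarrow> complex) \<Rightarrow> complex \<Rightarrow> real \<Rightarrow> complex" where
  "mellin_integrand f s t = of_real t powr (s - 1) * f t"

text \<open>
  \<open>F\<close> is a meromorphic continuation to the whole plane of the Mellin integral of \<open>f\<close>, which is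
  required to converge absolutely on some vertical strip of positive width.  The points of
  absolute convergence form a vertical strip, so \<open>F\<close> is determined by \<open>f\<close> up to its values on a
  set without accumulation points.  Identities between such continuations are therefore stated
  with the quantifier \<open>\<forall>\<^sub>\<approx>\<close>.
\<close>
definition is_mellin_transform :: "(real \<Rightarrow> complex) \<Rightarrow> (complex \<Rightarrow> complex) \<Rightarrow> bool" where
  "is_mellin_transform f F \<longleftrightarrow>
     F meromorphic_on UNIV \<and>
     (\<exists>u v :: real. u < v \<and>
        (\<forall>s. u < Re s \<and> Re s < v \<longrightarrow>
           set_integrable lborel {0<..} (mellin_integrand f s) \<and>
           F s = (LBINT t:{0<..}. mellin_integrand f s t)))"

definition gamma_quotient ::
  "nat \<Rightarrow> (nat \<Rightarrow> real) \<Rightarrow> (nat \<Rightarrow> complex) \<Rightarrow> nat \<Rightarrow> (nat \<Rightarrow> real) \<Rightarrow> (nat \<Rightarrow> complex) \<Rightarrow>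
   complex \<Rightarrow> complex" where
  "gamma_quotient N a b M c d s =
     (\<Prod>i<N. Gamma (of_real (a i) * s + b i)) / (\<Prod>j<M. Gamma (of_real (c j) * s + d j))"

definition class_H :: "(complex \<Rightarrow> complex) set" where
  "class_H = {gamma_quotient N a b M c d | N a b M c d.
                (\<forall>i<N. 0 < a i) \<and> (\<forall>j<M. 0 < c j)}"

definition class_Q :: "(complex \<Rightarrow> complex) set" where
  "class_Q = {(\<lambda>s. H s * exp (P s)) | H P. H \<in> class_H \<and> P holomorphic_on UNIV}"

definition kernel_transform :: "complex \<Rightarrow> complex" where
  "kernel_transform s = of_real pi * exp (\<i> * of_real pi * (1 - s) / 2) / sin (of_real pi * s)"

definition model_in_Q :: "(real \<Rightarrow> complex) \<Rightarrow> real \<Rightarrow> bool" where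
  "model_in_Q G Ginf \<longleftrightarrow>
     (\<exists>Gt H. is_mellin_transform (\<lambda>\<omega>. G \<omega> - of_real Ginf) Gt \<and>
             H \<in> class_Q \<and> \<not> (\<forall>\<^sub>\<approx>s\<in>UNIV. H s = 0) \<and>
             (\<forall>\<^sub>\<approx>s\<in>UNIV. Gt s = kernel_transform s * H (- s)))"

definition pole_lattice :: "(complex \<Rightarrow> complex) \<Rightarrow> complex set" where
  "pole_lattice F = {s. is_pole F s}"

text \<open>
  \<open>L\<close> is the pole lattice of the numerator Gamma factors in some representation of \<open>F\<close> as a
  quotient of Gamma factors times the exponential of an entire function.  Negative slopes are
  allowed here, as the transforms of the moduli contain factors such as \<open>\<Gamma>(1 - s / \<alpha>)\<close>.
  \<open>F\<close> does not determine \<open>L\<close>, because factors may cancel, but \<open>L\<close> always contains all poles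
  of \<open>F\<close>.
\<close>
definition has_gamma_lattice :: "(complex \<Rightarrow> complex) \<Rightarrow> complex set \<Rightarrow> bool" where
  "has_gamma_lattice F L \<longleftrightarrow>
     (\<exists>N a b M c d P.
        (\<forall>i<N. a i \<noteq> 0) \<and> (\<forall>j<M. c j \<noteq> 0) \<and> P holomorphic_on UNIV \<and>
        (\<forall>\<^sub>\<approx>s\<in>UNIV. F s = gamma_quotient N a b M c d s * exp (P s)) \<and>
        L = {s. \<exists>i<N. of_real (a i) * s + b i \<in> \<int>\<^sub>\<le>\<^sub>0})"

definition lattice_compatible :: "complex set \<Rightarrow> complex set \<Rightarrow> bool" where
  "lattice_compatible LG LH \<longleftrightarrow> LG \<subseteq> \<int> \<union> uminus ` LH \<and> LH \<subseteq> \<int> \<union> uminus ` LG"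

text \<open>
  The transform of the modulus exists and has a Gamma lattice, and no such lattice (however the
  Gamma factors are chosen) is compatible with the pole lattice of any member of \<open>class_Q\<close>.
\<close>
definition lattice_incompatible_with_Q :: "(real \<Rightarrow> complex) \<Rightarrow> real \<Rightarrow> bool" where
  "lattice_incompatible_with_Q G Ginf \<longleftrightarrow>
     (\<exists>Gt. is_mellin_transform (\<lambda>\<omega>. G \<omega> - of_real Ginf) Gt \<and>
           (\<exists>LG. has_gamma_lattice Gt LG) \<and>
           (\<forall>LG. has_gamma_lattice Gt LG \<longrightarrow>
              (\<forall>H\<in>class_Q. \<not> lattice_compatible LG (pole_lattice H))))"

definition cole_cole :: "real \<Rightarrow> real \<Rightarrow> real \<Rightarrow> real \<Rightarrow> real \<Rightarrow> complex" where
  "cole_cole G0 Ginf \<tau> \<alpha> \<omega> =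
     of_real Ginf + of_real (G0 - Ginf) / (1 + (\<i> * of_real \<omega> * of_real \<tau>) powr (- of_real \<alpha>))"

definition havriliak_negami ::
  "real \<Rightarrow> real \<Rightarrow> real \<Rightarrow> real \<Rightarrow> real \<Rightarrow> real \<Rightarrow> complex" where
  "havriliak_negami G0 Ginf \<tau> \<alpha> \<beta> \<omega> =
     of_real Ginf +
     of_real (G0 - Ginf) / (1 + (\<i> * of_real \<omega> * of_real \<tau>) powr of_real \<alpha>) powr of_real \<beta>"

definition fractional_zener :: "real \<Rightarrow> real \<Rightarrow> real \<Rightarrow> real \<Rightarrow> real \<Rightarrow> complex" where
  "fractional_zener Ge \<delta> \<tau> \<alpha> \<omega> =
     of_real Ge * (1 + (\<i> * of_real \<omega> * of_real \<tau>) powr of_real \<alpha>) /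
     (1 + of_real \<delta> * (\<i> * of_real \<omega> * of_real \<tau>) powr of_real \<alpha>)"

end

theory Submission
  imports Defs
begin

text \<open>
  Up to the additive constant \<open>G\<^sub>\<infinity>\<close>, each of the three moduli has the form
  \<open>C t\<^sup>\<gamma> (1 + w t\<^sup>\<alpha>)\<^sup>-\<^sup>\<beta>\<close> with \<open>Re w > 0\<close>; its Mellin transform is a multiple of
  \<open>\<Gamma>(p) \<Gamma>(\<beta> - p) w\<^sup>-\<^sup>p\<close> with \<open>p = (s + \<gamma>) / \<alpha>\<close>.  The factor \<open>\<Gamma>(p)\<close> has poles at \<open>- \<gamma> - \<alpha> k\<close> for
  all naturals \<open>k\<close>.  Since \<open>\<alpha> < 1\<close>, infinitely many of them are not integers, and these run off to
  the left.  They can be accounted for neither by the kernel, whose poles are integers, nor by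
  \<open>H(- s)\<close>: the slopes of the Gamma factors of \<open>H\<close> are positive, so the poles of \<open>H(- s)\<close> stay in
  a right half-plane.
\<close>

subsection \<open>The Mellin transform of a complex exponential\<close>

text \<open>Differentiation under the integral sign by dominated convergence along sequences.
  Convexity of \<open>S\<close> turns the bound on \<open>f'\<close> into a bound on difference
  quotients.\<close>

lemma has_field_derivative_lebesgue_integral:
  fixes f f' :: "complex \<Rightarrow> 'a \<Rightarrow> complex"
  assumes "convex S" "w \<in> S"
    and int: "\<And>z. z \<in> S \<Longrightarrow> integrable M (f z)"
    and der: "\<And>z x. z \<in> S \<Longrightarrow> ((\<lambda>z. f z x) has_field_derivative f' z x) (at z within S)"
    and g: "integrable M g" "\<And>z x. z \<in> S \<Longrightarrow> norm (f' z x) \<le> g x"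
    and meas: "f' w \<in> borel_measurable M"
  shows "((\<lambda>z. integral\<^sup>L M (f z)) has_field_derivative integral\<^sup>L M (f' w)) (at w within S)"
  unfolding has_field_derivative_iff tendsto_at_iff_sequentially comp_def
proof (intro allI impI)
  fix X assume X: "\<forall>i. X i \<in> S - {w}" "X \<longlonglongrightarrow> w"
  have "(\<lambda>n. \<integral>x. (f (X n) x - f w x) / (X n - w) \<partial>M) \<longlonglongrightarrow> integral\<^sup>L M (f' w)"
  proof (rule integral_dominated_convergence)
    show "AE x in M. (\<lambda>n. (f (X n) x - f w x) / (X n - w)) \<longlonglongrightarrow> f' w x"
      using der[OF \<open>w \<in> S\<close>] X
      unfolding has_field_derivative_iff tendsto_at_iff_sequentially comp_def by blast
    show "AE x in M. norm ((f (X n) x - f w x) / (X n - w)) \<le> g x" for n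
    proof (intro AE_I2)
      fix x
      \<comment> \<open>Mean value inequality on the segment from \<open>w\<close> to
        \<open>X n\<close>.\<close>
      have "norm (f (X n) x - f w x) \<le> g x * norm (X n - w)"
        using X(1) by (intro field_differentiable_bound[OF \<open>convex S\<close> der g(2)] \<open>w \<in> S\<close>) auto
      then show "norm ((f (X n) x - f w x) / (X n - w)) \<le> g x"
        using X(1) by (auto simp: norm_divide divide_le_eq)
    qed
    show "(\<lambda>x. (f (X n) x - f w x) / (X n - w)) \<in> borel_measurable M" for n
      using int[of "X n"] int[of w] X(1) \<open>w \<in> S\<close> by (auto intro!: borel_measurable_divide)
  qed (use g meas in auto)
  moreover have "(\<integral>x. (f (X n) x - f w x) / (X n - w) \<partial>M) =
      (integral\<^sup>L M (f (X n)) - integral\<^sup>L M (f w)) / (X n - w)" for n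
    using int[of "X n"] int[of w] X(1) \<open>w \<in> S\<close>
    by (subst integral_divide_zero, subst Bochner_Integration.integral_diff) auto
  ultimately show "(\<lambda>n. (integral\<^sup>L M (f (X n)) - integral\<^sup>L M (f w)) / (X n - w)) \<longlonglongrightarrow> integral\<^sup>L M (f' w)"
    using X(1) by simp
qed

text \<open>Euler's integral and the change of variables are available for
  \<open>absolutely_integrable_on\<close>, hence for the completed measure, whereas Mellin
  transforms are defined over \<open>lborel\<close>. Borel measurability bridges the two.\<close>

lemma set_integral_lborel_eq_integral:
  fixes f :: "real \<Rightarrow> 'a::euclidean_space"
  assumes "S \<in> sets borel" "set_borel_measurable borel S f" "f absolutely_integrable_on S"
  shows "set_integrable lborel S f" "(LBINT x:S. f x) = integral S f"
proof -
  show *: "set_integrable lborel S f"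
    using assms unfolding set_integrable_def set_borel_measurable_def
    by (subst (asm) integrable_completion) auto
  show "(LBINT x:S. f x) = integral S f"
    using set_borel_integral_eq_integral[OF *] by simp
qed

lemma exp_mellin_integrable_real:
  assumes "0 < Re p" "0 < a"
  shows "set_integrable lborel {0<..} (\<lambda>t. of_real t powr (p - 1) * exp (- (complex_of_real a * of_real t)))"
proof -
  have "(\<lambda>t. complex_of_real t powr (p - 1) / of_real (exp (a * t))) absolutely_integrable_on {0<..}"
    using assms by (intro absolutely_integrable_Gamma_integral)
  then have "set_integrable lborel {0<..} (\<lambda>t. complex_of_real t powr (p - 1) / of_real (exp (a * t)))"
    by (intro set_integral_lborel_eq_integral) (auto simp: set_borel_measurable_def)
  then show ?thesis
    by (simp add: exp_minus divide_inverse exp_of_real[symmetric])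
qed

text \<open>The modulus of \<open>exp (- (w * of_real t))\<close> depends on \<open>Re w\<close>
  only, so the case of real \<open>w\<close> provides the dominating function.\<close>

lemma exp_mellin_integrable:
  assumes "0 < Re p" "0 < Re w"
  shows "set_integrable lborel {0<..} (\<lambda>t. of_real t powr (p - 1) * exp (- (w * of_real t)))"
proof (rule set_integrable_bound)
  show "set_integrable lborel {0<..} (\<lambda>t. of_real t powr (p - 1) * exp (- (complex_of_real (Re w) * of_real t)))"
    using assms by (rule exp_mellin_integrable_real)
qed (auto simp: set_borel_measurable_def norm_mult)

text \<open>For real \<open>w\<close> this is Euler's integral after rescaling \<open>t\<close>.
  Both sides are holomorphic in \<open>w\<close> on the right half-plane, so the identity theorem
  gives the complex case.\<close>

lemma exp_mellin_integral:
  assumes "0 < Re p" "0 < Re w"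
  shows "(LBINT t:{0<..}. of_real t powr (p - 1) * exp (- (w * of_real t))) = Gamma p * w powr (- p)"
proof -
  define S where "S = {w. 0 < Re w}"
  define I where "I = (\<lambda>w. LBINT t:{0<..}. of_real t powr (p - 1) * exp (- (w * of_real t)))"
  have S: "open S" "convex S" by (auto simp: S_def open_halfspace_Re_gt convex_halfspace_Re_gt)
  have "I holomorphic_on S"
  proof (rule holomorphic_onI)
    fix w0 assume "w0 \<in> S"
    \<comment> \<open>On this smaller half-plane the factor \<open>exp (- (Re w0 / 2) * t)\<close>
      dominates uniformly, which no decaying exponential does on all of \<open>S\<close>.\<close>
    define T where "T = {w. Re w > Re w0 / 2}"
    have T: "open T" "convex T"
      unfolding T_def by (rule open_halfspace_Re_gt convex_halfspace_Re_gt)+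
    have T': "w0 \<in> T" "\<And>w. w \<in> T \<Longrightarrow> Re w > 0"
      using \<open>w0 \<in> S\<close> by (auto simp: T_def S_def)
    have "\<exists>D. (I has_field_derivative D) (at w0 within T)"
      unfolding I_def set_lebesgue_integral_def
    proof (rule exI, rule has_field_derivative_lebesgue_integral[OF T(2) T'(1)])
      show "integrable lborel (\<lambda>t. indicat_real {0<..} t *\<^sub>R
              (complex_of_real t powr (p - 1) * exp (- (z * of_real t))))" if "z \<in> T" for z
        using exp_mellin_integrable[OF assms(1) T'(2)[OF that]] by (simp add: set_integrable_def)
      have "set_integrable lborel {0<..} (\<lambda>t. of_real t powr ((p + 1) - 1) *
              exp (- (complex_of_real (Re w0 / 2) * of_real t)))"
        using assms \<open>w0 \<in> S\<close> by (intro exp_mellin_integrable_real) (auto simp: S_def)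
      then show "integrable lborel (\<lambda>t. norm (indicat_real {0<..} t *\<^sub>R (complex_of_real t powr p *
              exp (- (complex_of_real (Re w0 / 2) * of_real t)))))"
        unfolding set_integrable_def by (intro integrable_norm) simp
      show "((\<lambda>z. indicat_real {0<..} t *\<^sub>R (complex_of_real t powr (p - 1) * exp (- (z * of_real t))))
          has_field_derivative indicat_real {0<..} t *\<^sub>R (- of_real t * complex_of_real t powr (p - 1) * 
             exp (- (z * of_real t)))) (at z within T)" for z t
        by (cases "t > 0") (auto intro!: derivative_eq_intros)
      show "norm (indicat_real {0<..} t *\<^sub>R (- of_real t * complex_of_real t powr (p - 1) * 
             exp (- (z * of_real t)))) \<le> norm (indicat_real {0<..} t *\<^sub>R (complex_of_real t powr p *
              exp (- (complex_of_real (Re w0 / 2) * of_real t))))" if "z \<in> T" for z t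
      proof (cases "t > 0")
        case True
        have "complex_of_real t * complex_of_real t powr (p - 1) = of_real t powr p"
          using True by (simp add: powr_diff)
        then have "norm (complex_of_real t) * norm (complex_of_real t powr (p - 1)) = norm (complex_of_real t powr p)"
          by (metis norm_mult)
        then show ?thesis using that True
          by (auto simp: T_def norm_mult intro!: mult_left_mono mult_right_mono)
      qed auto
    qed auto
    then show "I field_differentiable at w0 within S"
      using T(1) T'(1) unfolding field_differentiable_def
      by (metis at_within_open field_differentiable_at_within field_differentiable_def)
  qed
  then have hol: "(\<lambda>w. I w - Gamma p * w powr (- p)) holomorphic_on S"
    by (intro holomorphic_intros) (auto simp: S_def complex_nonpos_Reals_iff)
  have real: "I (of_real a) = Gamma p * of_real a powr (- p)" if "a > 0" for a
  proof -
    have ai: "(\<lambda>t. complex_of_real t powr (p - 1) / of_real (exp t)) absolutely_integrable_on {0<..}"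
      using assms by (intro absolutely_integrable_Gamma_integral')
    have "(LBINT t:{0<..}. complex_of_real t powr (p - 1) / of_real (exp t)) =
       integral {0<..} (\<lambda>t. complex_of_real t powr (p - 1) / of_real (exp t))"
      by (intro set_integral_lborel_eq_integral ai) (auto simp: set_borel_measurable_def)
    also have "\<dots> = Gamma p"
      using Gamma_integral_complex'[OF assms(1)] by (rule integral_unique)
    finally have "Gamma p = (LBINT t. indicator {0<..} t *\<^sub>R (complex_of_real t powr (p - 1) / of_real (exp t)))"
      unfolding set_lebesgue_integral_def by simp
    also have "\<dots> = a *\<^sub>R (LBINT t. indicator {0<..} (0 + a * t) *\<^sub>R
        (complex_of_real (0 + a * t) powr (p - 1) / of_real (exp (0 + a * t))))"
      using that by (subst lborel_integral_real_affine[where c = a and t = 0]) auto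
    also have "\<dots> = a *\<^sub>R (LBINT t. of_real a powr (p - 1) * (indicator {0<..} t *\<^sub>R
        (complex_of_real t powr (p - 1) * exp (- (of_real a * of_real t)))))"
      using that
      by (intro arg_cong[where f = "\<lambda>x. a *\<^sub>R x"] Bochner_Integration.integral_cong refl)
         (auto simp: indicator_def zero_less_mult_iff powr_times_real exp_minus field_simps exp_of_real[symmetric])
    also have "\<dots> = of_real a powr p * I (of_real a)"
      using that unfolding integral_mult_right_zero I_def set_lebesgue_integral_def
      by (simp add: powr_diff[of "of_real a"] scaleR_conv_of_real)
    finally show ?thesis using that by (simp add: powr_minus field_simps)
  qed
  have "I w - Gamma p * w powr (- p) = 0"
  proof (rule analytic_continuation[OF hol S(1) convex_connected[OF S(2)], where U = "of_real ` {0<..}" and \<xi> = 1])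
    \<comment> \<open>The identity theorem needs a point of \<open>S\<close> at which the positive
      reals accumulate; 1 is approached from the right.\<close>
    have "(\<lambda>n. complex_of_real (1 + inverse (real (Suc n)))) \<longlonglongrightarrow> of_real (1 + 0)"
      by (intro tendsto_of_real tendsto_intros LIMSEQ_inverse_real_of_nat)
    then show "(1::complex) islimpt complex_of_real ` {0<..}"
      unfolding islimpt_sequential
      by (intro exI[of _ "\<lambda>n. complex_of_real (1 + inverse (real (Suc n)))"])
         (auto simp: complex_eq_iff intro!: imageI add_pos_nonneg simp del: of_nat_Suc of_real_add of_real_inverse)
  qed (use assms real in \<open>auto simp: S_def\<close>)
  then show ?thesis by (simp add: I_def)
qed

subsection \<open>The Mellin transform of a binomial\<close>

lemma Gamma_of_real_nonzero:
  assumes "0 < x"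
  shows "Gamma (complex_of_real x) \<noteq> 0"
  using Gamma_real_pos[OF assms] by (metis Gamma_complex_of_real less_irrefl of_real_eq_0_iff)

text \<open>Euler's integral writes \<open>Gamma \<beta> * (1 + w * y) powr (- \<beta>)\<close> as
  an integral over \<open>t\<close>. Exchanging the integrations, the one over \<open>y\<close>
  gives \<open>Gamma p * (t * w) powr (- p)\<close> and the one over \<open>t\<close> then gives
  \<open>Gamma (\<beta> - p)\<close>.\<close>

lemma binomial_mellin:
  fixes \<beta> :: real and p w :: complex
  assumes "0 < Re p" "Re p < \<beta>" "0 < Re w"
  defines "g \<equiv> \<lambda>y. of_real y powr (p - 1) * (1 + w * of_real y) powr (- of_real \<beta>)"
  shows "set_integrable lborel {0<..} g"
    and "(LBINT y:{0<..}. g y) = Gamma p * Gamma (of_real \<beta> - p) / Gamma (of_real \<beta>) * w powr (- p)"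
proof -
  \<comment> \<open>The parameters \<open>p\<close> and \<open>w\<close> stay explicit because the
    norm of \<open>f p w\<close> is again of this form, with \<open>Re p\<close> and
    \<open>Re w\<close>. The computation \<open>inner\<close> thus also yields the absolute
    integrability that Fubini requires.\<close>
  define f :: "complex \<Rightarrow> complex \<Rightarrow> real \<Rightarrow> real \<Rightarrow> complex" where
    "f = (\<lambda>p w t y. indicator {0<..} t *\<^sub>R indicator {0<..} y *\<^sub>R
      (of_real t powr (of_real \<beta> - 1) * exp (- of_real t) *
       (of_real y powr (p - 1) * exp (- (of_real t * w * of_real y)))))"
  \<comment> \<open>What remains after integrating over \<open>y\<close>: the integrand of
    \<open>Gamma (\<beta> - p)\<close>. The factor 1 is the value of \<open>w\<close> at which
    \<open>exp_mellin_integral\<close> is applied.\<close>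
  define e where "e = (\<lambda>p (t::real). indicator {0<..} t *\<^sub>R
      (of_real t powr ((of_real \<beta> - p) - 1) * exp (- (1 * complex_of_real t))))"
  have inner: "integrable lborel (f p w t) \<and>
      (LBINT y. f p w t y) = Gamma p * w powr (- p) * e p t"
    if "0 < Re p" "0 < Re w" for p w t
  proof (cases "t > 0")
    case True
    have "0 < Re (of_real t * w)" using True that by simp
    note E = exp_mellin_integrable[OF that(1) this] exp_mellin_integral[OF that(1) this]
    have f: "f p w t = (\<lambda>y. (of_real t powr (of_real \<beta> - 1) * exp (- of_real t)) *
        (indicator {0<..} y *\<^sub>R (of_real y powr (p - 1) * exp (- (of_real t * w * of_real y)))))"
      using True by (auto simp: f_def fun_eq_iff)
    have "integrable lborel (f p w t)"
      using E(1) unfolding f set_integrable_def by (rule integrable_mult_right)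
    moreover have "(LBINT y. f p w t y) =
        of_real t powr (of_real \<beta> - 1) * exp (- of_real t) * (Gamma p * (of_real t * w) powr (- p))"
      using E(2) unfolding f set_lebesgue_integral_def integral_mult_right_zero by simp
    moreover have "(of_real t * w) powr (- p) = of_real t powr (- p) * w powr (- p)"
      using True by (intro powr_times_real_left) auto
    moreover have "complex_of_real t powr ((of_real \<beta> - p) - 1) =
        of_real t powr (of_real \<beta> - 1) * of_real t powr (- p)"
      by (simp add: powr_add[symmetric] algebra_simps)
    ultimately show ?thesis
      using True by (simp add: e_def)
  qed (auto simp: f_def e_def)
  have e_int: "integrable lborel (e p)" if "Re p < \<beta>" for p
    using exp_mellin_integrable[of "of_real \<beta> - p" 1] that by (simp add: e_def set_integrable_def)
  have "complex_of_real (norm (of_real y powr q)) = of_real y powr of_real (Re q)" if "y > 0" for y q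
    using that by (simp add: norm_powr_real_powr powr_of_real)
  then have nrm: "complex_of_real (norm (f p w t y)) = f (of_real (Re p)) (of_real (Re w)) t y" for t y
    by (auto simp: f_def norm_mult indicator_def exp_of_real[symmetric])
  have "complex_of_real (LBINT y. norm (f p w t y)) =
      Gamma (of_real (Re p)) * of_real (Re w) powr (- of_real (Re p)) * e (of_real (Re p)) t" for t
    using inner[of "of_real (Re p)" "of_real (Re w)" t] assms(1,3)
    by (simp add: nrm integral_complex_of_real[symmetric] del: integral_complex_of_real)
  then have "integrable lborel (\<lambda>t. complex_of_real (LBINT y. norm (f p w t y)))"
    using e_int[of "of_real (Re p)"] assms(2) by simp
  then have 1: "integrable lborel (\<lambda>t. LBINT y. norm (f p w t y))"
    by (simp only: complex_of_real_integrable_eq)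
  have f_int: "integrable (lborel \<Otimes>\<^sub>M lborel) (case_prod (f p w))"
  proof (rule lborel_pair.Fubini_integrable)
    show "case_prod (f p w) \<in> borel_measurable (lborel \<Otimes>\<^sub>M lborel)"
      unfolding f_def by measurable
  qed (use 1 inner assms in auto)
  have outer: "(LBINT t. f p w t y) = Gamma (of_real \<beta>) * (indicator {0<..} y *\<^sub>R g y)" for y
  proof (cases "y > 0")
    case True
    have "0 < Re (1 + w * of_real y)" using True assms by (simp add: add_pos_pos)
    then have E: "(LBINT t:{0<..}. of_real t powr (of_real \<beta> - 1) * exp (- ((1 + w * of_real y) * of_real t)))
      = Gamma (of_real \<beta>) * (1 + w * of_real y) powr (- of_real \<beta>)"
      using assms by (intro exp_mellin_integral) auto
    have "(LBINT t. f p w t y) = (LBINT t. of_real y powr (p - 1) * (indicator {0<..} t *\<^sub>R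
       (of_real t powr (of_real \<beta> - 1) * exp (- ((1 + w * of_real y) * of_real t)))))"
      using True by (auto simp: f_def indicator_def exp_add[symmetric] algebra_simps
          intro!: Bochner_Integration.integral_cong)
    also have "\<dots> = Gamma (of_real \<beta>) * g y"
      using E unfolding integral_mult_right_zero set_lebesgue_integral_def g_def by simp
    finally show ?thesis using True by simp
  qed (simp add: f_def)
  have \<beta>: "Gamma (complex_of_real \<beta>) \<noteq> 0"
    using assms by (intro Gamma_of_real_nonzero) linarith
  have "integrable lborel (\<lambda>y. Gamma (of_real \<beta>) * (indicator {0<..} y *\<^sub>R g y))"
    using lborel_pair.integrable_snd[OF f_int] by (simp add: outer)
  then have "integrable lborel (\<lambda>y. inverse (Gamma (of_real \<beta>)) *
      (Gamma (of_real \<beta>) * (indicator {0<..} y *\<^sub>R g y)))"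
    by (rule integrable_mult_right)
  also have "(\<lambda>y. inverse (Gamma (of_real \<beta>)) * (Gamma (of_real \<beta>) * (indicator {0<..} y *\<^sub>R g y))) =
      (\<lambda>y. indicator {0<..} y *\<^sub>R g y)"
    using \<beta> by (simp add: mult.assoc[symmetric] del: mult_scaleR_right)
  finally show "set_integrable lborel {0<..} g"
    by (simp add: set_integrable_def)
  have "Gamma (of_real \<beta>) * (LBINT y. indicator {0<..} y *\<^sub>R g y) = (LBINT y. LBINT t. f p w t y)"
    by (simp only: outer integral_mult_right_zero)
  also have "\<dots> = (LBINT t. LBINT y. f p w t y)"
    using f_int by (rule lborel_pair.Fubini_integral)
  also have "\<dots> = Gamma p * w powr (- p) * (LBINT t. e p t)"
    using inner assms by simp
  also have "(LBINT t. e p t) = Gamma (of_real \<beta> - p)"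
    using exp_mellin_integral[of "of_real \<beta> - p" 1] assms
    by (simp add: e_def set_lebesgue_integral_def)
  finally show "(LBINT y:{0<..}. g y) =
      Gamma p * Gamma (of_real \<beta> - p) / Gamma (of_real \<beta>) * w powr (- p)"
    using \<beta> by (simp add: set_lebesgue_integral_def field_simps)
qed

text \<open>Since \<open>\<alpha> > 0\<close>, the map \<open>x powr \<alpha>\<close> is a bijection
  of the positive reals; it reduces the variable \<open>t powr \<alpha>\<close> of the responses to
  the plain variable of \<open>binomial_mellin\<close>.\<close>

lemma set_integral_power_substitution:
  fixes f :: "real \<Rightarrow> 'a :: euclidean_space"
  assumes "0 < \<alpha>" and f: "set_integrable lborel {0<..} f"
  defines "g \<equiv> \<lambda>x. (\<alpha> * x powr (\<alpha> - 1)) *\<^sub>R f (x powr \<alpha>)"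
  shows "set_integrable lborel {0<..} g" "(LBINT x:{0<..}. g x) = (LBINT x:{0<..}. f x)"
proof -
  have img: "(\<lambda>x. x powr \<alpha>) ` {0<..} = {0<..}"
  proof -
    have "y = (y powr (1 / \<alpha>)) powr \<alpha>" if "y > 0" for y :: real
      using that assms by (simp add: powr_powr)
    then have "y \<in> (\<lambda>x. x powr \<alpha>) ` {0<..}" if "y > 0" for y :: real
      using that by (intro image_eqI[of _ _ "y powr (1 / \<alpha>)"]) auto
    then show ?thesis by auto
  qed
  have lf: "f absolutely_integrable_on {0<..}" "integral {0<..} f = (LBINT x:{0<..}. f x)"
    using f set_borel_integral_eq_integral[OF f]
    by (auto simp: set_integrable_def integrable_completion borel_measurable_integrable)
  have "(\<lambda>x. \<bar>\<alpha> * x powr (\<alpha> - 1)\<bar> *\<^sub>R f (x powr \<alpha>)) absolutely_integrable_on {0<..} \<and>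
      integral {0<..} (\<lambda>x. \<bar>\<alpha> * x powr (\<alpha> - 1)\<bar> *\<^sub>R f (x powr \<alpha>)) = (LBINT x:{0<..}. f x)"
  proof (subst has_absolute_integral_change_of_variables_real)
    show "((\<lambda>x. x powr \<alpha>) has_real_derivative \<alpha> * x powr (\<alpha> - 1)) (at x within {0<..})"
      if "x \<in> {0<..}" for x
      using that by (intro has_field_derivative_at_within[OF has_real_derivative_powr]) auto
    show "inj_on (\<lambda>x. x powr \<alpha>) {0<..}"
      using assms by (intro inj_on_inverseI[of _ "\<lambda>y. y powr (1 / \<alpha>)"]) (simp add: powr_powr)
  qed (use img lf in auto)
  then have *: "g absolutely_integrable_on {0<..}" "integral {0<..} g = (LBINT x:{0<..}. f x)"
    using assms by (simp_all add: g_def)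
  \<comment> \<open>Measurability of \<open>f\<close> is known only after multiplication by the
    indicator, so a second indicator is inserted at \<open>x powr \<alpha>\<close>; it equals 1 for
    positive \<open>x\<close>.\<close>
  have "(\<lambda>x. indicator {0<..} x *\<^sub>R ((\<alpha> * x powr (\<alpha> - 1)) *\<^sub>R (indicator {0<..} (x powr \<alpha>) *\<^sub>R f (x powr \<alpha>))))
     \<in> borel_measurable borel"
    using f[unfolded set_integrable_def, THEN borel_measurable_integrable] by measurable
  also have "(\<lambda>x. indicator {0<..} x *\<^sub>R ((\<alpha> * x powr (\<alpha> - 1)) *\<^sub>R
      (indicator {0<..} (x powr \<alpha>) *\<^sub>R f (x powr \<alpha>)))) = (\<lambda>x. indicator {0<..} x *\<^sub>R g x)"
    by (auto simp: g_def indicator_def)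
  finally have "set_borel_measurable borel {0<..} g"
    by (simp add: set_borel_measurable_def)
  then show "set_integrable lborel {0<..} g" "(LBINT x:{0<..}. g x) = (LBINT x:{0<..}. f x)"
    using set_integral_lborel_eq_integral[OF _ _ *(1)] *(2) by auto
qed

subsection \<open>Power-law responses and their Mellin transforms\<close>

text \<open>Here \<open>t powr \<alpha>\<close> is a real power: the relaxation time and the phase
  \<open>\<i> powr \<alpha>\<close> are absorbed into \<open>w\<close>. Cole-Cole has
  \<open>\<beta> = 1\<close> and \<open>\<gamma> = \<alpha>\<close>, Havriliak-Negami has
  \<open>\<gamma> = 0\<close>, and fractional Zener has \<open>\<beta> = 1\<close> and
  \<open>\<gamma> = 0\<close>.\<close>

definition power_response :: "complex \<Rightarrow> complex \<Rightarrow> real \<Rightarrow> real \<Rightarrow> real \<Rightarrow> real \<Rightarrow> complex" where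
  "power_response C w \<alpha> \<beta> \<gamma> t =
     C * of_real t powr of_real \<gamma> * (1 + w * of_real (t powr \<alpha>)) powr (- of_real \<beta>)"

text \<open>Apart from \<open>C / \<alpha>\<close> and the power of \<open>w\<close>, this is the
  Beta function at \<open>p\<close> and \<open>\<beta> - p\<close>, written with Gamma so that it is
  meromorphic in the whole plane.\<close>

definition power_response_mellin ::
  "complex \<Rightarrow> complex \<Rightarrow> real \<Rightarrow> real \<Rightarrow> real \<Rightarrow> complex \<Rightarrow> complex" where
  "power_response_mellin C w \<alpha> \<beta> \<gamma> s =
     (let p = (s + of_real \<gamma>) / of_real \<alpha> in
       C / (of_real \<alpha> * Gamma (of_real \<beta>)) * (Gamma p * Gamma (of_real \<beta> - p) * w powr (- p)))"

text \<open>Substituting \<open>y = t powr \<alpha>\<close> leads to \<open>binomial_mellin\<close>;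
  the strip is the condition \<open>0 < Re p < \<beta>\<close>.\<close>

lemma mellin_integral_power_response:
  assumes "0 < \<alpha>" "0 < Re w" "- \<gamma> < Re s" "Re s < \<alpha> * \<beta> - \<gamma>"
  shows "set_integrable lborel {0<..} (mellin_integrand (power_response C w \<alpha> \<beta> \<gamma>) s)"
    and "(LBINT t:{0<..}. mellin_integrand (power_response C w \<alpha> \<beta> \<gamma>) s t) =
      power_response_mellin C w \<alpha> \<beta> \<gamma> s"
proof -
  define p where "p = (s + of_real \<gamma>) / of_real \<alpha>"
  define f where "f y = of_real y powr (p - 1) * (1 + w * of_real y) powr (- of_real \<beta>)" for y
  define g where "g x = (\<alpha> * x powr (\<alpha> - 1)) *\<^sub>R f (x powr \<alpha>)" for x
  have p: "0 < Re p" "Re p < \<beta>"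
    using assms by (auto simp: p_def field_simps)
  note f = binomial_mellin[OF p \<open>0 < Re w\<close>, folded f_def]
  note g = set_integral_power_substitution[OF \<open>0 < \<alpha>\<close> f(1), folded g_def]
  \<comment> \<open>All powers of \<open>x\<close> are written as exponentials of
    \<open>ln x\<close>, so that only
    \<open>(\<alpha> - 1) + \<alpha> * (p - 1) = (s - 1) + \<gamma>\<close> has to be
    checked.\<close>
  have eq: "mellin_integrand (power_response C w \<alpha> \<beta> \<gamma>) s x = C / of_real \<alpha> * g x" if "x > 0" for x
  proof -
    have pow: "complex_of_real y powr z = exp (z * of_real (ln y))" if "y > 0" for y z
      using that by (simp add: powr_def Ln_of_real)
    have "complex_of_real (x powr (\<alpha> - 1)) = exp ((of_real \<alpha> - 1) * of_real (ln x))"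
      using that by (simp add: powr_def flip: exp_of_real)
    moreover have "complex_of_real (x powr \<alpha>) powr (p - 1) = exp ((p - 1) * (of_real \<alpha> * of_real (ln x)))"
      using that by (simp add: pow)
    moreover have "(of_real \<alpha> - 1) * of_real (ln x) + (p - 1) * (of_real \<alpha> * of_real (ln x)) =
        (s - 1) * of_real (ln x) + of_real \<gamma> * of_real (ln x)"
      using assms(1) by (simp add: p_def field_simps)
    ultimately have "complex_of_real (x powr (\<alpha> - 1)) * of_real (x powr \<alpha>) powr (p - 1) =
        of_real x powr (s - 1) * of_real x powr of_real \<gamma>"
      using that by (simp only: pow exp_add[symmetric])
    then have "C / of_real \<alpha> * g x = C * (of_real x powr (s - 1) * of_real x powr of_real \<gamma>) *
        (1 + w * of_real (x powr \<alpha>)) powr (- of_real \<beta>)"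
      using assms(1) by (simp add: g_def f_def scaleR_conv_of_real)
    then show ?thesis
      by (simp add: mellin_integrand_def power_response_def mult_ac)
  qed
  have I: "indicator {0<..} x *\<^sub>R mellin_integrand (power_response C w \<alpha> \<beta> \<gamma>) s x =
      C / of_real \<alpha> * (indicator {0<..} x *\<^sub>R g x)" for x :: real
    using eq by (auto simp: indicator_def)
  show "set_integrable lborel {0<..} (mellin_integrand (power_response C w \<alpha> \<beta> \<gamma>) s)"
    using g(1) unfolding set_integrable_def I by (rule integrable_mult_right)
  show "(LBINT t:{0<..}. mellin_integrand (power_response C w \<alpha> \<beta> \<gamma>) s t) =
      power_response_mellin C w \<alpha> \<beta> \<gamma> s"
    using g(2) f(2) unfolding set_lebesgue_integral_def I integral_mult_right_zero
    by (simp add: power_response_mellin_def Let_def p_def)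
qed

section \<open>Sharpness of the strip of convergence\<close>

text \<open>The right-hand side is independent of \<open>a\<close> and \<open>b\<close>, so a lower
  bound \<open>c / t\<close> with \<open>c > 0\<close> all the way to 0 or to infinity refutes
  integrability.\<close>

lemma set_integrable_imp_ln_bound:
  fixes g :: "real \<Rightarrow> complex"
  assumes "set_integrable lborel {0<..} g" "0 < a" "a \<le> b"
    and "\<And>t. a \<le> t \<Longrightarrow> t \<le> b \<Longrightarrow> c / t \<le> norm (g t)"
  shows "c * (ln b - ln a) \<le> (LBINT t:{0<..}. norm (g t))"
proof -
  have int: "set_integrable lborel {0<..} (\<lambda>t. norm (g t))"
    using assms(1) by (rule set_integrable_norm)
  have int': "set_integrable lborel {a..b} (\<lambda>t. norm (g t))"
    using assms(2) by (intro set_integrable_subset[OF int]) auto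
  have "((\<lambda>t. c / t) has_integral (c * ln b - c * ln a)) {a..b}"
    using assms(2,3)
    by (intro fundamental_theorem_of_calculus)
       (auto intro!: derivative_eq_intros simp flip: has_real_derivative_iff_has_vector_derivative)
  then have "c * ln b - c * ln a \<le> integral {a..b} (\<lambda>t. norm (g t))"
    using set_borel_integral_eq_integral(1)[OF int'] assms(4)
    by (intro has_integral_le[OF _ integrable_integral]) auto
  also have "\<dots> \<le> integral {0<..} (\<lambda>t. norm (g t))"
    using set_borel_integral_eq_integral(1)[OF int'] set_borel_integral_eq_integral(1)[OF int] assms(2)
    by (intro integral_subset_le) auto
  finally show ?thesis
    using set_borel_integral_eq_integral(2)[OF int] by (simp add: algebra_simps)
qed

text \<open>\<open>is_mellin_transform\<close> leaves the choice of the strip open, so strips beyond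
  the computed one have to be excluded. Outside its closure the integrand dominates a multiple of
  \<open>1 / t\<close> near 0 or near infinity.\<close>

lemma mellin_integrable_power_response_imp:
  assumes "C \<noteq> 0" "0 < \<alpha>" "0 < \<beta>" "0 < Re w"
    and int: "set_integrable lborel {0<..} (mellin_integrand (power_response C w \<alpha> \<beta> \<gamma>) s)"
  shows "- \<gamma> \<le> Re s" "Re s \<le> \<alpha> * \<beta> - \<gamma>"
proof -
  define g where "g = mellin_integrand (power_response C w \<alpha> \<beta> \<gamma>) s"
  define c where "c = norm C * (1 + norm w) powr (- \<beta>)"
  define I where "I = (LBINT t:{0<..}. norm (g t))"
  have "0 < 1 + norm w" by (simp add: add_pos_nonneg)
  then have "0 < c" using assms(1) by (simp add: c_def)
  \<comment> \<open>\<open>M\<close> is a common bound for 1 and \<open>t powr \<alpha>\<close>: it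
    will be 1 for \<open>t \<le> 1\<close> and \<open>t powr \<alpha>\<close> for
    \<open>t \<ge> 1\<close>.\<close>
  have low: "norm (g t) \<ge> c * (t powr (Re s + \<gamma> - 1) * M powr (- \<beta>))"
    if t: "t > 0" "1 \<le> M" "t powr \<alpha> \<le> M" for t M
  proof -
    have "0 < Re (1 + w * of_real (t powr \<alpha>))"
      using assms(4) t(1) by (simp add: add_pos_pos)
    then have nz: "1 + w * of_real (t powr \<alpha>) \<noteq> 0" by (metis less_irrefl zero_complex.sel(1))
    have "norm (1 + w * of_real (t powr \<alpha>)) \<le> 1 + norm w * t powr \<alpha>"
      by (intro order.trans[OF norm_triangle_ineq]) (simp add: norm_mult)
    also have "\<dots> \<le> M + norm w * M"
      using t by (intro add_mono mult_left_mono) auto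
    finally have "norm (1 + w * of_real (t powr \<alpha>)) \<le> (1 + norm w) * M"
      by (simp add: algebra_simps)
    then have "((1 + norm w) * M) powr (- \<beta>) \<le> norm (1 + w * of_real (t powr \<alpha>)) powr (- \<beta>)"
      using assms(3) nz by (intro powr_mono2') auto
    moreover have "norm (g t) =
        norm C * t powr (Re s + \<gamma> - 1) * norm (1 + w * of_real (t powr \<alpha>)) powr (- \<beta>)"
      using t(1)
      by (simp add: g_def mellin_integrand_def power_response_def norm_mult norm_powr_real_powr
          norm_powr_real_powr' powr_add[symmetric] algebra_simps flip: of_real_minus)
    moreover have "c * (t powr (Re s + \<gamma> - 1) * M powr (- \<beta>)) =
        norm C * t powr (Re s + \<gamma> - 1) * ((1 + norm w) * M) powr (- \<beta>)"
      using t(2) by (simp add: c_def powr_mult mult_ac)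
    moreover have "0 \<le> norm C * t powr (Re s + \<gamma> - 1)" by simp
    ultimately show ?thesis
      by (metis mult_left_mono)
  qed
  have n: "\<exists>n::nat. I < c * real n"
    using reals_Archimedean3[OF \<open>0 < c\<close>] by (metis mult.commute)
  have powr: "t powr (-1) = 1 / t" if "t > 0" for t :: real
    using that by (simp add: powr_minus_divide)
  show "- \<gamma> \<le> Re s"
  proof (rule ccontr)
    assume neg: "\<not> - \<gamma> \<le> Re s"
    obtain n :: nat where n: "I < c * real n" using n by blast
    \<comment> \<open>On this interval \<open>c / t\<close> integrates to \<open>c * real n\<close>,
      more than the whole integral \<open>I\<close>.\<close>
    have "c * (ln 1 - ln (exp (- real n))) \<le> I"
      unfolding I_def
    proof (rule set_integrable_imp_ln_bound)
      fix t :: real assume t: "exp (- real n) \<le> t" "t \<le> 1"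
      have "0 < t" using t(1) by (rule less_le_trans[OF exp_gt_zero])
      then have "t powr (-1) \<le> t powr (Re s + \<gamma> - 1)"
        using t(2) neg by (intro powr_mono') auto
      moreover have "t powr \<alpha> \<le> 1"
        using \<open>0 < t\<close> t(2) assms(2) by (intro powr_le1) auto
      ultimately have "c * t powr (-1) \<le> norm (g t)"
        using low[of t 1] \<open>0 < t\<close> mult_left_mono[of _ _ c] \<open>0 < c\<close> by fastforce
      then show "c / t \<le> norm (g t)"
        using powr[OF \<open>0 < t\<close>] by simp
    qed (use int in \<open>auto simp: g_def\<close>)
    then show False using n by simp
  qed
  show "Re s \<le> \<alpha> * \<beta> - \<gamma>"
  proof (rule ccontr)
    assume neg: "\<not> Re s \<le> \<alpha> * \<beta> - \<gamma>"
    obtain n :: nat where n: "I < c * real n" using n by blast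
    have "c * (ln (exp (real n)) - ln 1) \<le> I"
      unfolding I_def
    proof (rule set_integrable_imp_ln_bound)
      fix t :: real assume t: "1 \<le> t" "t \<le> exp (real n)"
      have "t powr (-1) \<le> t powr ((Re s + \<gamma> - 1) + \<alpha> * (- \<beta>))"
        using t(1) neg by (intro powr_mono) auto
      also have "\<dots> = t powr (Re s + \<gamma> - 1) * (t powr \<alpha>) powr (- \<beta>)"
        by (simp only: powr_powr powr_add)
      finally have "c * t powr (-1) \<le> c * (t powr (Re s + \<gamma> - 1) * (t powr \<alpha>) powr (- \<beta>))"
        using \<open>0 < c\<close> by (intro mult_left_mono) auto
      also have "\<dots> \<le> norm (g t)"
        using t(1) assms(2) by (intro low ge_one_powr_ge_zero) auto
      finally show "c / t \<le> norm (g t)"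
        using powr[of t] t(1) by simp
    qed (use int in \<open>auto simp: g_def\<close>)
    then show False using n by simp
  qed
qed

section \<open>Meromorphic continuation and its uniqueness\<close>

text \<open>Gamma is the inverse of the entire function \<open>rGamma\<close>, even at its poles,
  where both sides take the value 0.\<close>

lemma meromorphic_on_Gamma [meromorphic_intros]:
  assumes "f analytic_on A"
  shows "(\<lambda>z. Gamma (f z)) meromorphic_on A"
proof -
  have "(\<lambda>z. inverse (rGamma (f z))) meromorphic_on A"
    using assms by (intro meromorphic_intros analytic_on_imp_meromorphic_on analytic_intros)
  then show ?thesis by (simp add: rGamma_inverse_Gamma)
qed

lemma analytic_on_powr_exponent:
  assumes "f analytic_on A" "w \<noteq> (0 :: complex)"
  shows "(\<lambda>s. w powr f s) analytic_on A"
  using assms by (auto simp: powr_def intro!: analytic_intros)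

text \<open>Identity theorem: after its removable singularities are removed, the difference vanishes
  near \<open>x\<close> and hence everywhere. The values at the sparse set of singularities stay
  undetermined.\<close>

lemma meromorphic_eq_cosparse:
  assumes "f meromorphic_on UNIV" "g meromorphic_on UNIV" "eventually (\<lambda>z. f z = g z) (at x)"
  shows "\<forall>\<^sub>\<approx>z\<in>UNIV. f z = g z"
proof -
  define h where "h = (\<lambda>z. f z - g z)"
  have h: "h meromorphic_on UNIV"
    unfolding h_def using assms by (intro meromorphic_intros)
  have "eventually (\<lambda>z. remove_sings h z = 0) (at x)"
    using eventually_cosparse_imp_eventually_at[OF eventually_remove_sings_eq[OF h] UNIV_I] assms(3)
    by eventually_elim (simp add: h_def)
  then have 0: "remove_sings h z = 0" for z
    using h
    by (intro frequently_eq_meromorphic_imp_constant[of "remove_sings h" 0 x UNIV])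
       (auto simp: eventually_frequently remove_sings_nicely_meromorphic)
  show ?thesis
    using eventually_remove_sings_eq[OF h] by eventually_elim (use 0 in \<open>simp add: h_def\<close>)
qed

lemma is_mellin_transform_power_response:
  assumes "0 < \<alpha>" "0 < \<beta>" "0 < Re w"
  shows "is_mellin_transform (power_response C w \<alpha> \<beta> \<gamma>) (power_response_mellin C w \<alpha> \<beta> \<gamma>)"
  unfolding is_mellin_transform_def
proof (intro conjI exI allI impI)
  have "w \<noteq> 0" using assms by auto
  then show "power_response_mellin C w \<alpha> \<beta> \<gamma> meromorphic_on UNIV"
    unfolding power_response_mellin_def[abs_def] Let_def using assms
    by (intro meromorphic_intros analytic_on_imp_meromorphic_on) (auto intro!: analytic_intros analytic_on_powr_exponent)
  show "- \<gamma> < \<alpha> * \<beta> - \<gamma>" using assms by simp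
qed (use assms mellin_integral_power_response in auto)

text \<open>The strip on which \<open>F\<close> is given by the integral lies in the strip of the
  closed formula, so both functions agree on an open set.\<close>

lemma is_mellin_transform_power_response_unique:
  assumes "C \<noteq> 0" "0 < \<alpha>" "0 < \<beta>" "0 < Re w"
    and F: "is_mellin_transform (power_response C w \<alpha> \<beta> \<gamma>) F"
  shows "\<forall>\<^sub>\<approx>s\<in>UNIV. F s = power_response_mellin C w \<alpha> \<beta> \<gamma> s"
proof -
  from F obtain u v where uv: "u < v"
    and I: "\<And>s. u < Re s \<Longrightarrow> Re s < v \<Longrightarrow>
      set_integrable lborel {0<..} (mellin_integrand (power_response C w \<alpha> \<beta> \<gamma>) s) \<and>
      F s = (LBINT t:{0<..}. mellin_integrand (power_response C w \<alpha> \<beta> \<gamma>) s t)"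
    unfolding is_mellin_transform_def by blast
  have "- \<gamma> \<le> x \<and> x \<le> \<alpha> * \<beta> - \<gamma>" if "u < x" "x < v" for x
    using mellin_integrable_power_response_imp[OF assms(1-4), of \<gamma> "of_real x"] I[of "of_real x"] that
    by auto
  \<comment> \<open>By density the closed bounds pass from the points of the open interval to its
    ends, which puts the open strip of \<open>F\<close> inside the open strip of the
    formula.\<close>
  then have bd: "- \<gamma> \<le> u" "v \<le> \<alpha> * \<beta> - \<gamma>"
    using uv by (meson dense_ge_bounded dense_le_bounded)+
  show ?thesis
  proof (rule meromorphic_eq_cosparse)
    show "F meromorphic_on UNIV" using F by (simp add: is_mellin_transform_def)
    show "power_response_mellin C w \<alpha> \<beta> \<gamma> meromorphic_on UNIV"
      using is_mellin_transform_power_response[OF assms(2-4)] by (simp add: is_mellin_transform_def)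
    have "open ({s. u < Re s} \<inter> {s. Re s < v})"
      by (intro open_Int open_halfspace_Re_gt open_halfspace_Re_lt)
    then have "eventually (\<lambda>s. s \<in> {s. u < Re s} \<inter> {s. Re s < v}) (at (of_real ((u + v) / 2)))"
      using uv by (intro eventually_at_in_open') auto
    then show "eventually (\<lambda>s. F s = power_response_mellin C w \<alpha> \<beta> \<gamma> s) (at (of_real ((u + v) / 2)))"
      using I mellin_integral_power_response(2)[OF assms(2,4)] bd
      by (elim eventually_mono) fastforce
  qed
qed

subsection \<open>Poles and lattices\<close>

text \<open>The denominator contributes the entire function \<open>rGamma\<close>, so only numerator
  factors can produce poles.\<close>

lemma analytic_gamma_quotient:
  assumes "\<And>i. i < N \<Longrightarrow> of_real (a i) * s + b i \<notin> \<int>\<^sub>\<le>\<^sub>0"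
  shows "gamma_quotient N a b M c d analytic_on {s}"
proof -
  have "(\<lambda>s. (\<Prod>i<N. Gamma (of_real (a i) * s + b i)) * (\<Prod>j<M. rGamma (of_real (c j) * s + d j)))
      analytic_on {s}"
    using assms by (intro analytic_intros) auto
  moreover have "gamma_quotient N a b M c d =
      (\<lambda>s. (\<Prod>i<N. Gamma (of_real (a i) * s + b i)) * (\<Prod>j<M. rGamma (of_real (c j) * s + d j)))"
    by (simp add: gamma_quotient_def fun_eq_iff divide_inverse rGamma_inverse_Gamma prod_inversef[symmetric] comp_def)
  ultimately show ?thesis by simp
qed

text \<open>Cancellation can make \<open>L\<close> larger than the set of poles, but off
  \<open>L\<close> the representing function is analytic, and a pole is not affected by changes on a
  sparse set.\<close>

lemma has_gamma_lattice_pole: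
  assumes "has_gamma_lattice F L" "is_pole F s"
  shows "s \<in> L"
proof (rule ccontr)
  assume "s \<notin> L"
  obtain N a b M c d P where P: "P holomorphic_on UNIV"
    and ev: "\<forall>\<^sub>\<approx>s\<in>UNIV. F s = gamma_quotient N a b M c d s * exp (P s)"
    and L: "L = {s. \<exists>i<N. of_real (a i) * s + b i \<in> \<int>\<^sub>\<le>\<^sub>0}"
    using assms(1) unfolding has_gamma_lattice_def by auto
  have "(\<lambda>s. gamma_quotient N a b M c d s * exp (P s)) analytic_on {s}"
    using \<open>s \<notin> L\<close> P
    by (intro analytic_intros analytic_gamma_quotient)
       (auto simp: L analytic_on_holomorphic)
  then have "\<not> is_pole (\<lambda>s. gamma_quotient N a b M c d s * exp (P s)) s"
    by (rule analytic_at_imp_no_pole)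
  with assms(2) is_pole_cong[OF eventually_cosparse_imp_eventually_at[OF ev UNIV_I] refl]
  show False by blast
qed

lemma class_Q_analytic_right:
  assumes "H \<in> class_Q"
  obtains B where "\<And>s. B < Re s \<Longrightarrow> H analytic_on {s}"
proof -
  obtain N a b M c d P where a: "\<forall>i<N. 0 < a i" and P: "P holomorphic_on UNIV"
    and H: "H = (\<lambda>s. gamma_quotient N a b M c d s * exp (P s))"
    using assms by (auto simp: class_Q_def class_H_def)
  \<comment> \<open>Factor \<open>i\<close> has an argument of positive real part once
    \<open>Re s > - Re (b i) / a i\<close>. The sum dominates all these thresholds and is meaningful
    for \<open>N = 0\<close> too.\<close>
  define B where "B = (\<Sum>i<N. \<bar>Re (b i) / a i\<bar>)"
  have "H analytic_on {s}" if "B < Re s" for s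
    unfolding H
  proof (intro analytic_intros analytic_gamma_quotient)
    show "P analytic_on {s}" using P by (auto simp: analytic_on_holomorphic)
    fix i assume i: "i < N"
    have "\<bar>Re (b i) / a i\<bar> \<le> B"
      unfolding B_def using i by (intro member_le_sum) auto
    then have "- (Re (b i) / a i) < Re s" using that by linarith
    then have "0 < a i * Re s + Re (b i)"
      using a i by (simp add: field_simps)
    then show "of_real (a i) * s + b i \<notin> \<int>\<^sub>\<le>\<^sub>0"
      by (auto simp: nonpos_Ints_def dest!: arg_cong[of _ _ Re])
  qed
  then show thesis using that by blast
qed

text \<open>At \<open>p = - k\<close> the other Gamma factor has the argument
  \<open>\<beta> + k > 0\<close>, where it is finite and nonzero, so the pole of
  \<open>Gamma p\<close> does not cancel.\<close>

lemma is_pole_power_response_mellin: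
  assumes "C \<noteq> 0" "0 < \<alpha>" "0 < \<beta>" "w \<noteq> 0"
  shows "is_pole (power_response_mellin C w \<alpha> \<beta> \<gamma>) (- of_real (\<gamma> + \<alpha> * real k))"
proof -
  define z :: complex where "z = - of_real (\<gamma> + \<alpha> * real k)"
  define p where "p s = (s + of_real \<gamma>) / of_real \<alpha>" for s :: complex
  define R where "R s = C / (of_real \<alpha> * Gamma (of_real \<beta>)) * (Gamma (of_real \<beta> - p s) * w powr (- p s))" for s
  have pz: "p z = - of_nat k"
    using assms by (simp add: p_def z_def field_simps)
  have pos: "x \<notin> \<int>\<^sub>\<le>\<^sub>0" if "0 < Re x" for x :: complex
    using that by (auto simp: nonpos_Ints_def)
  have p_an: "p analytic_on S" for S
    unfolding p_def[abs_def] using assms by (auto intro!: analytic_intros)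
  have "s = of_real \<alpha> * p s - of_real \<gamma>" for s
    using assms by (simp add: p_def)
  then have p_inj: "p s \<noteq> p z" if "s \<noteq> z" for s
    using that by metis
  \<comment> \<open>Poles are limits over punctured neighbourhoods, so \<open>p\<close> must also
    avoid the value \<open>- k\<close> away from \<open>z\<close>; this is injectivity of the affine
    map \<open>p\<close>.\<close>
  have "filterlim p (at (- of_nat k)) (at z)"
    unfolding filterlim_at
  proof
    show "eventually (\<lambda>s. p s \<in> UNIV \<and> p s \<noteq> - of_nat k) (at z)"
      unfolding eventually_at_filter pz[symmetric] using p_inj by (intro always_eventually) auto
    show "(p \<longlongrightarrow> - of_nat k) (at z)"
      using analytic_at_imp_isCont[OF p_an, of z] by (simp add: isCont_def pz)
  qed
  then have "is_pole (\<lambda>s. Gamma (p s)) z"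
    using is_pole_Gamma[of k] unfolding is_pole_def by (rule filterlim_compose[rotated])
  moreover have "R analytic_on {z}"
    unfolding R_def using p_an[of "{z}"] pos[of "of_real \<beta> - p z"] pos[of "of_real \<beta>"] assms
    by (intro analytic_intros analytic_on_powr_exponent) (auto simp: pz Gamma_eq_zero_iff)
  moreover have "R z \<noteq> 0"
    using pos[of "of_real \<beta> - p z"] pos[of "of_real \<beta>"] assms
    by (auto simp: R_def pz Gamma_eq_zero_iff)
  ultimately have "is_pole (\<lambda>s. R s * Gamma (p s)) z"
    by (intro is_pole_mult_analytic_nonzero1)
  moreover have "power_response_mellin C w \<alpha> \<beta> \<gamma> = (\<lambda>s. R s * Gamma (p s))"
    by (simp add: power_response_mellin_def R_def p_def Let_def fun_eq_iff mult_ac)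
  ultimately show ?thesis by (simp add: z_def)
qed

text \<open>Consecutive poles differ by \<open>\<alpha> < 1\<close>, so they cannot both be integers.\<close>
lemma nonintegral_pole_power_response_mellin:
  assumes "C \<noteq> 0" "0 < \<alpha>" "\<alpha> < 1" "0 < \<beta>" "w \<noteq> 0"
  obtains s where "is_pole (power_response_mellin C w \<alpha> \<beta> \<gamma>) s" "Re s < B" "s \<notin> \<int>"
proof -
  obtain k :: nat where k: "real k * \<alpha> > - B - \<gamma>"
    using reals_Archimedean3[OF \<open>0 < \<alpha>\<close>] by blast
  define s :: "nat \<Rightarrow> complex" where "s j = - of_real (\<gamma> + \<alpha> * real j)" for j
  have pole: "is_pole (power_response_mellin C w \<alpha> \<beta> \<gamma>) (s j)" for j
    unfolding s_def using assms by (intro is_pole_power_response_mellin)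
  have "s k - s (Suc k) = of_real \<alpha>"
    by (simp add: s_def algebra_simps)
  moreover have "complex_of_real \<alpha> \<notin> \<int>"
    using assms(2,3) by (auto elim!: Ints_cases simp: complex_eq_iff)
  ultimately have "s k \<notin> \<int> \<or> s (Suc k) \<notin> \<int>"
    by (metis Ints_diff)
  moreover have "Re (s k) < B" "Re (s (Suc k)) < B"
    using k assms(2) by (auto simp: s_def algebra_simps)
  ultimately show thesis using pole that by blast
qed

text \<open>Ensures that the incompatibility claim about all Gamma lattices is not vacuous.\<close>

lemma has_gamma_lattice_power_response_mellin:
  assumes "C \<noteq> 0" "0 < \<alpha>" "0 < \<beta>" "w \<noteq> 0"
  shows "\<exists>L. has_gamma_lattice (power_response_mellin C w \<alpha> \<beta> \<gamma>) L"
proof -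
  define D where "D = C / (of_real \<alpha> * Gamma (of_real \<beta>))"
  \<comment> \<open>Index 0 encodes \<open>Gamma p\<close> and index 1 encodes
    \<open>Gamma (\<beta> - p)\<close>, with negative slope. The nonzero constant \<open>D\<close>
    and \<open>w powr (- p)\<close> go into the exponential \<open>P\<close>.\<close>
  define a where "a = (\<lambda>i::nat. if i = 0 then 1 / \<alpha> else - 1 / \<alpha>)"
  define b where "b = (\<lambda>i::nat. if i = 0 then complex_of_real (\<gamma> / \<alpha>) else of_real (\<beta> - \<gamma> / \<alpha>))"
  define P where "P s = Ln D - (s + of_real \<gamma>) / of_real \<alpha> * Ln w" for s
  have "D \<noteq> 0"
    using assms Gamma_of_real_nonzero[of \<beta>] by (simp add: D_def)
  have "power_response_mellin C w \<alpha> \<beta> \<gamma> s = gamma_quotient 2 a b 0 (\<lambda>_. 1) (\<lambda>_. 0) s * exp (P s)" for s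
  proof -
    define p where "p = (s + of_real \<gamma>) / of_real \<alpha>"
    have "of_real (1 / \<alpha>) * s + of_real (\<gamma> / \<alpha>) = p"
      "of_real (- 1 / \<alpha>) * s + of_real (\<beta> - \<gamma> / \<alpha>) = of_real \<beta> - p"
      using assms by (simp_all add: p_def field_simps)
    moreover have "gamma_quotient 2 a b 0 (\<lambda>_. 1) (\<lambda>_. 0) s =
        Gamma (of_real (1 / \<alpha>) * s + of_real (\<gamma> / \<alpha>)) *
        Gamma (of_real (- 1 / \<alpha>) * s + of_real (\<beta> - \<gamma> / \<alpha>))"
      by (simp add: gamma_quotient_def a_def b_def numeral_2_eq_2)
    moreover have "exp (P s) = D * w powr (- p)"
      using \<open>D \<noteq> 0\<close> assms by (simp add: P_def p_def exp_diff powr_def exp_minus divide_inverse)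
    ultimately show ?thesis
      by (simp only: power_response_mellin_def Let_def p_def[symmetric] D_def[symmetric] mult_ac)
  qed
  moreover have "P holomorphic_on UNIV"
    unfolding P_def using assms by (intro holomorphic_intros) auto
  moreover have "\<forall>i<2. a i \<noteq> 0" using assms by (simp add: a_def)
  ultimately show ?thesis
    unfolding has_gamma_lattice_def
    by (intro exI[of _ "{s. \<exists>i<2. of_real (a i) * s + b i \<in> \<int>\<^sub>\<le>\<^sub>0}"] exI[of _ "2::nat"] exI[of _ a] exI[of _ b]
        exI[of _ "0::nat"] exI[of _ "\<lambda>_. 1"] exI[of _ "\<lambda>_. 0"] exI[of _ P]) simp
qed

section \<open>Excluding power-law and constant responses\<close>

text \<open>The integral sees positive \<open>t\<close> only, and the closed forms of the moduli are
  established only there.\<close>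

lemma is_mellin_transform_cong:
  assumes "\<And>t. t > 0 \<Longrightarrow> f t = g t"
  shows "is_mellin_transform f F \<longleftrightarrow> is_mellin_transform g F"
proof -
  have *: "indicator {0<..} t *\<^sub>R mellin_integrand f s t = indicator {0<..} t *\<^sub>R mellin_integrand g s t"
    for s t
    using assms by (auto simp: indicator_def mellin_integrand_def)
  then show ?thesis
    unfolding is_mellin_transform_def set_integrable_def set_lebesgue_integral_def by (simp only: *)
qed

text \<open>The constitutive equation involves \<open>H (- s)\<close>, while non-triviality is
  stated for \<open>H s\<close>.\<close>

lemma eventually_cosparse_reflect:
  assumes "\<forall>\<^sub>\<approx>s\<in>UNIV. P s"
  shows "\<forall>\<^sub>\<approx>s\<in>UNIV. P (- s :: complex)"
proof -
  have "filterlim uminus (at (- x)) (at x)" for x :: complex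
    by (auto simp: filterlim_at eventually_at_filter intro!: tendsto_intros)
  then show ?thesis
    using assms by (auto simp: eventually_cosparse_open_eq dest: eventually_compose_filterlim)
qed

text \<open>The exponential never vanishes and the sine is nonzero off the integers, which form a
  closed set of isolated points. At integers, division by zero yields the value 0.\<close>

lemma kernel_transform_nonzero: "\<forall>\<^sub>\<approx>s\<in>UNIV. kernel_transform s \<noteq> 0"
proof -
  have "eventually (\<lambda>s. s \<notin> \<int>) (at x)" for x :: complex
  proof (cases "x \<in> \<int>")
    case True
    have "s \<notin> \<int>" if "s \<noteq> x" "dist s x < 1" for s
    proof
      assume "s \<in> \<int>"
      then obtain k where "s - x = of_int k" using True by (metis Ints_cases Ints_diff)
      then have "k = 0" using that(2) by (simp add: dist_norm)
      then show False using \<open>s - x = of_int k\<close> that(1) by simp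
    qed
    then show ?thesis by (auto simp: eventually_at intro!: exI[of _ 1])
  next
    case False
    then show ?thesis
      using eventually_at_in_open'[of "- \<int>" x] by (simp add: closed_Ints open_Compl)
  qed
  then have "\<forall>\<^sub>\<approx>s\<in>UNIV. s \<notin> (\<int> :: complex set)"
    by (simp add: eventually_cosparse_open_eq)
  then show ?thesis
  proof eventually_elim
    case (elim s)
    then have "sin (of_real pi * s) \<noteq> 0"
      by (auto simp: sin_eq_0 mult.commute)
    then show ?case by (simp add: kernel_transform_def)
  qed
qed

lemma analytic_kernel_transform:
  assumes "s \<notin> \<int>"
  shows "kernel_transform analytic_on {s}"
  unfolding kernel_transform_def[abs_def] using assms
  by (auto intro!: analytic_intros simp: sin_eq_0 mult.commute)

text \<open>At a non-integral pole far enough to the left, both factors of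
  \<open>kernel_transform s * H (- s)\<close> are analytic.\<close>

lemma not_model_in_Q_power_response:
  assumes "C \<noteq> 0" "0 < \<alpha>" "\<alpha> < 1" "0 < \<beta>" "0 < Re w"
    and G: "\<And>t. t > 0 \<Longrightarrow> G t - of_real Ginf = power_response C w \<alpha> \<beta> \<gamma> t"
  shows "\<not> model_in_Q G Ginf"
proof
  assume "model_in_Q G Ginf"
  then obtain Gt H where Gt: "is_mellin_transform (power_response C w \<alpha> \<beta> \<gamma>) Gt"
    and H: "H \<in> class_Q" and eq: "\<forall>\<^sub>\<approx>s\<in>UNIV. Gt s = kernel_transform s * H (- s)"
    unfolding model_in_Q_def
    using is_mellin_transform_cong[of "\<lambda>t. G t - of_real Ginf" "power_response C w \<alpha> \<beta> \<gamma>"] G by auto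
  obtain B where B: "\<And>s. B < Re s \<Longrightarrow> H analytic_on {s}"
    using class_Q_analytic_right[OF H] by blast
  have "w \<noteq> 0" using assms by auto
  \<comment> \<open>The bound \<open>- B\<close> places \<open>- s\<close> in the half-plane where
    \<open>H\<close> is analytic.\<close>
  then obtain s where s: "is_pole (power_response_mellin C w \<alpha> \<beta> \<gamma>) s" "Re s < - B" "s \<notin> \<int>"
    using nonintegral_pole_power_response_mellin[OF assms(1-4)] by blast
  have "\<forall>\<^sub>\<approx>s\<in>UNIV. power_response_mellin C w \<alpha> \<beta> \<gamma> s = kernel_transform s * H (- s)"
    using is_mellin_transform_power_response_unique[OF assms(1,2,4,5) Gt] eq
    by eventually_elim simp
  from eventually_cosparse_imp_eventually_at[OF this UNIV_I]
  have "is_pole (\<lambda>s. kernel_transform s * H (- s)) s"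
    by (rule is_pole_transform[OF s(1) _ refl])
  moreover have "(\<lambda>s. H (- s)) analytic_on {s}"
    using analytic_on_compose[of uminus "{s}" H] B[of "- s"] s(2)
    by (simp add: comp_def analytic_on_neg)
  then have "(\<lambda>s. kernel_transform s * H (- s)) analytic_on {s}"
    using s(3) by (intro analytic_on_mult analytic_kernel_transform)
  ultimately show False
    using analytic_at_imp_no_pole by blast
qed

text \<open>The same kind of pole lies in every Gamma lattice of the transform, but it is neither an
  integer nor the negative of a pole of \<open>H\<close>.\<close>

lemma lattice_incompatible_power_response:
  assumes "C \<noteq> 0" "0 < \<alpha>" "\<alpha> < 1" "0 < \<beta>" "0 < Re w"
    and G: "\<And>t. t > 0 \<Longrightarrow> G t - of_real Ginf = power_response C w \<alpha> \<beta> \<gamma> t"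
  shows "lattice_incompatible_with_Q G Ginf"
proof -
  define F where "F = power_response_mellin C w \<alpha> \<beta> \<gamma>"
  have "w \<noteq> 0" using assms by auto
  have "is_mellin_transform (\<lambda>t. G t - of_real Ginf) F"
    using is_mellin_transform_power_response[OF assms(2,4,5)] 
      is_mellin_transform_cong[of "\<lambda>t. G t - of_real Ginf" "power_response C w \<alpha> \<beta> \<gamma>"] G
    by (simp add: F_def)
  moreover have "\<exists>L. has_gamma_lattice F L"
    using has_gamma_lattice_power_response_mellin[OF assms(1,2,4) \<open>w \<noteq> 0\<close>] by (simp add: F_def)
  moreover have "\<not> lattice_compatible L (pole_lattice H)"
    if L: "has_gamma_lattice F L" and H: "H \<in> class_Q" for L H
  proof
    assume "lattice_compatible L (pole_lattice H)"
    then have sub: "L \<subseteq> \<int> \<union> uminus ` pole_lattice H" by (simp add: lattice_compatible_def)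
    obtain B where B: "\<And>s. B < Re s \<Longrightarrow> H analytic_on {s}"
      using class_Q_analytic_right[OF H] by blast
    obtain s where s: "is_pole F s" "Re s < - B" "s \<notin> \<int>"
      unfolding F_def using nonintegral_pole_power_response_mellin[OF assms(1-4) \<open>w \<noteq> 0\<close>] by blast
    have "s \<in> L" using L s(1) by (rule has_gamma_lattice_pole)
    then have "is_pole H (- s)" using sub s(3) by (auto simp: pole_lattice_def)
    then show False using B[of "- s"] s(2) analytic_at_imp_no_pole by auto
  qed
  ultimately show ?thesis unfolding lattice_incompatible_with_Q_def by blast
qed

text \<open>The transform of the zero response vanishes off a sparse set, which forces
  \<open>H\<close> to be trivial. This settles the degenerate case \<open>G0 = Ginf\<close>.\<close>

lemma not_model_in_Q_constant:
  assumes "\<And>t. t > 0 \<Longrightarrow> G t = of_real Ginf"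
  shows "\<not> model_in_Q G Ginf"
proof
  assume "model_in_Q G Ginf"
  then obtain Gt H where Gt: "is_mellin_transform (\<lambda>_. 0) Gt"
    and nz: "\<not> (\<forall>\<^sub>\<approx>s\<in>UNIV. H s = 0)" and eq: "\<forall>\<^sub>\<approx>s\<in>UNIV. Gt s = kernel_transform s * H (- s)"
    unfolding model_in_Q_def
    using is_mellin_transform_cong[of "\<lambda>t. G t - of_real Ginf" "\<lambda>_. 0"] assms by auto
  obtain u v where uv: "u < v" and Gt0: "\<And>s. u < Re s \<Longrightarrow> Re s < v \<Longrightarrow> Gt s = 0"
    using Gt by (auto simp: is_mellin_transform_def mellin_integrand_def)
  have "open ({s. u < Re s} \<inter> {s. Re s < v})"
    by (intro open_Int open_halfspace_Re_gt open_halfspace_Re_lt)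
  then have "eventually (\<lambda>s. s \<in> {s. u < Re s} \<inter> {s. Re s < v}) (at (of_real ((u + v) / 2)))"
    using uv by (intro eventually_at_in_open') auto
  then have "\<forall>\<^sub>\<approx>s\<in>UNIV. Gt s = 0"
    using Gt Gt0
    by (intro meromorphic_eq_cosparse) (auto simp: is_mellin_transform_def elim!: eventually_mono)
  then have "\<forall>\<^sub>\<approx>s\<in>UNIV. H (- s) = 0"
    using eq kernel_transform_nonzero by eventually_elim simp
  then show False using eventually_cosparse_reflect[of "\<lambda>s. H (- s) = 0"] nz by simp
qed

section \<open>Complex powers and the three models\<close>

text \<open>A positive real factor can be split off a principal power without crossing the branch
  cut.\<close>

lemma imaginary_powr:
  assumes "0 < t" "0 < \<tau>"
  shows "(\<i> * of_real t * of_real \<tau>) powr of_real \<alpha> =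
    of_real (\<tau> powr \<alpha>) * \<i> powr of_real \<alpha> * of_real (t powr \<alpha>)"
proof -
  have "(of_real (t * \<tau>) * \<i>) powr of_real \<alpha> = of_real (t * \<tau>) powr of_real \<alpha> * \<i> powr of_real \<alpha>"
    using assms by (intro powr_times_real_left) auto
  then show ?thesis
    using assms by (simp add: powr_of_real powr_mult mult_ac del: of_real_mult) (simp add: mult_ac)
qed

text \<open>The number \<open>\<i> powr \<alpha>\<close> has modulus 1 and argument
  \<open>\<alpha> * pi / 2 < pi / 2\<close>; this is the source of \<open>Re w > 0\<close>.\<close>

lemma Re_imaginary_powr_pos:
  assumes "0 < \<alpha>" "\<alpha> < 1"
  shows "0 < Re (\<i> powr of_real \<alpha>)"
proof -
  have "0 < cos (\<alpha> * pi / 2)"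
  proof (rule cos_gt_zero_pi)
    have "0 < \<alpha> * pi" "\<alpha> * pi < 1 * pi"
      using assms by (simp_all only: mult_pos_pos pi_gt_zero mult_strict_right_mono)
    then show "- (pi / 2) < \<alpha> * pi / 2" "\<alpha> * pi / 2 < pi / 2" by linarith+
  qed
  then show ?thesis by (simp add: powr_def Re_exp)
qed

theorem proposition6:
  fixes \<alpha> \<beta> \<tau> :: real
  assumes "0 < \<alpha>" "\<alpha> < 1" "0 < \<beta>" "\<beta> < 1" "0 < \<tau>"
  shows "(\<forall>G0 Ginf :: real.
            \<not> model_in_Q (cole_cole G0 Ginf \<tau> \<alpha>) Ginf \<and>
            (G0 \<noteq> Ginf \<longrightarrow> lattice_incompatible_with_Q (cole_cole G0 Ginf \<tau> \<alpha>) Ginf)) \<and>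
         (\<forall>G0 Ginf :: real.
            \<not> model_in_Q (havriliak_negami G0 Ginf \<tau> \<alpha> \<beta>) Ginf \<and>
            (G0 \<noteq> Ginf \<longrightarrow>
               lattice_incompatible_with_Q (havriliak_negami G0 Ginf \<tau> \<alpha> \<beta>) Ginf)) \<and>
         (\<forall>Ge Ginf \<delta> :: real. 0 < Ge \<and> 0 < Ginf \<and> \<delta> = Ge / Ginf \<and> \<delta> < 1 \<longrightarrow>
            \<not> model_in_Q (fractional_zener Ge \<delta> \<tau> \<alpha>) Ginf \<and>
            lattice_incompatible_with_Q (fractional_zener Ge \<delta> \<tau> \<alpha>) Ginf)"
proof -
  define w where "w = of_real (\<tau> powr \<alpha>) * \<i> powr of_real \<alpha>"
  have w: "0 < Re w"
    using Re_imaginary_powr_pos[OF assms(1,2)] assms(5) by (simp add: w_def)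
  have pw: "(\<i> * of_real t * of_real \<tau>) powr of_real \<alpha> = w * of_real (t powr \<alpha>)" if "t > 0" for t
    using imaginary_powr[OF that assms(5)] by (simp add: w_def)
  have w0: "w \<noteq> 0" using w by auto
  \<comment> \<open>The factor \<open>c\<close> is 1 for Cole-Cole and \<open>Ge / Ginf\<close> for
    fractional Zener.\<close>
  have nz: "1 + c *\<^sub>R w * of_real (t powr \<alpha>) \<noteq> 0" "w * of_real (t powr \<alpha>) \<noteq> 0"
    if "t > 0" "c > 0" for t c
  proof -
    have "0 < Re (1 + c *\<^sub>R w * of_real (t powr \<alpha>))"
      using that w by (simp add: add_pos_pos)
    then show "1 + c *\<^sub>R w * of_real (t powr \<alpha>) \<noteq> 0" by (metis less_irrefl zero_complex.sel(1))
    show "w * of_real (t powr \<alpha>) \<noteq> 0" using that w0 by auto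
  qed
  \<comment> \<open>Rewriting \<open>1 / (1 + inverse x)\<close> as \<open>x / (1 + x)\<close> with
    \<open>x = w * t powr \<alpha>\<close> moves \<open>w\<close> into the amplitude and makes
    \<open>\<gamma> = \<alpha>\<close>.\<close>
  have CC: "cole_cole G0 Ginf \<tau> \<alpha> t - of_real Ginf = power_response (of_real (G0 - Ginf) * w) w \<alpha> 1 \<alpha> t"
    if "t > 0" for G0 Ginf t
  proof -
    define x where "x = w * of_real (t powr \<alpha>)"
    have x: "x \<noteq> 0" "1 + x \<noteq> 0" "(\<i> * of_real t * of_real \<tau>) powr (- of_real \<alpha>) = inverse x"
      using nz[OF that zero_less_one] by (simp_all add: x_def powr_minus pw[OF that])
    then have "1 + inverse x \<noteq> 0" by (simp add: field_simps add.commute)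
    then have "of_real (G0 - Ginf) / (1 + inverse x) = of_real (G0 - Ginf) * x / (1 + x)"
      using x by (simp add: field_simps)
    moreover have "cole_cole G0 Ginf \<tau> \<alpha> t - of_real Ginf = of_real (G0 - Ginf) / (1 + inverse x)"
      by (simp add: cole_cole_def x(3))
    moreover have "power_response (of_real (G0 - Ginf) * w) w \<alpha> 1 \<alpha> t = of_real (G0 - Ginf) * x / (1 + x)"
      using that by (simp add: power_response_def powr_minus divide_inverse x_def powr_of_real[symmetric])
    ultimately show ?thesis by simp
  qed
  have HN: "havriliak_negami G0 Ginf \<tau> \<alpha> \<beta> t - of_real Ginf =
      power_response (of_real (G0 - Ginf)) w \<alpha> \<beta> 0 t" if "t > 0" for G0 Ginf t
    using that by (simp add: havriliak_negami_def power_response_def powr_minus pw divide_inverse)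
  \<comment> \<open>Since \<open>Ge = d * Ginf\<close>, subtracting \<open>Ginf\<close> cancels the
    terms in \<open>x\<close> of the numerator and leaves the constant
    \<open>Ge - Ginf\<close>.\<close>
  have FZ: "fractional_zener Ge (Ge / Ginf) \<tau> \<alpha> t - of_real Ginf =
      power_response (of_real (Ge - Ginf)) (of_real (Ge / Ginf) * w) \<alpha> 1 0 t"
    if "t > 0" "0 < Ge" "0 < Ginf" for Ge Ginf t
  proof -
    define x where "x = w * of_real (t powr \<alpha>)"
    define d where "d = complex_of_real (Ge / Ginf)"
    have "1 + d * x \<noteq> 0"
      using nz(1)[OF that(1), of "Ge / Ginf"] that by (simp add: x_def d_def scaleR_conv_of_real mult.assoc)
    moreover have Ge: "of_real Ge = d * of_real Ginf"
      using that by (simp add: d_def)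
    ultimately have "of_real Ge * (1 + x) / (1 + d * x) - of_real Ginf = of_real (Ge - Ginf) / (1 + d * x)"
      by (simp add: field_simps)
    moreover have "fractional_zener Ge (Ge / Ginf) \<tau> \<alpha> t = of_real Ge * (1 + x) / (1 + d * x)"
      by (simp only: fractional_zener_def pw[OF that(1)] x_def d_def)
    moreover have "power_response (of_real (Ge - Ginf)) (of_real (Ge / Ginf) * w) \<alpha> 1 0 t =
        of_real (Ge - Ginf) / (1 + d * x)"
      using that(1) by (simp add: power_response_def powr_minus divide_inverse x_def d_def mult.assoc)
    ultimately show ?thesis by simp
  qed
  have "\<not> model_in_Q (cole_cole G0 Ginf \<tau> \<alpha>) Ginf" for G0 Ginf
  proof (cases "G0 = Ginf")
    case True
    then show ?thesis by (intro not_model_in_Q_constant) (simp add: cole_cole_def)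
  next
    case False
    then show ?thesis
      using w w0 assms by (intro not_model_in_Q_power_response[OF _ _ _ _ _ CC]) auto
  qed
  moreover have "lattice_incompatible_with_Q (cole_cole G0 Ginf \<tau> \<alpha>) Ginf" if "G0 \<noteq> Ginf" for G0 Ginf
    using that w w0 assms by (intro lattice_incompatible_power_response[OF _ _ _ _ _ CC]) auto
  moreover have "\<not> model_in_Q (havriliak_negami G0 Ginf \<tau> \<alpha> \<beta>) Ginf" for G0 Ginf
  proof (cases "G0 = Ginf")
    case True
    then show ?thesis by (intro not_model_in_Q_constant) (simp add: havriliak_negami_def)
  next
    case False
    then show ?thesis
      using w assms by (intro not_model_in_Q_power_response[OF _ _ _ _ _ HN]) auto
  qed
  moreover have "lattice_incompatible_with_Q (havriliak_negami G0 Ginf \<tau> \<alpha> \<beta>) Ginf" if "G0 \<noteq> Ginf" for G0 Ginf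
    using that w assms by (intro lattice_incompatible_power_response[OF _ _ _ _ _ HN]) auto
  \<comment> \<open>From \<open>Ge / Ginf < 1\<close> the amplitude \<open>Ge - Ginf\<close> is
    nonzero, so no degenerate case arises.\<close>
  moreover have "\<not> model_in_Q (fractional_zener Ge (Ge / Ginf) \<tau> \<alpha>) Ginf \<and>
      lattice_incompatible_with_Q (fractional_zener Ge (Ge / Ginf) \<tau> \<alpha>) Ginf"
    if "0 < Ge" "0 < Ginf" "Ge / Ginf < 1" for Ge Ginf
    using that w assms
    by (intro conjI not_model_in_Q_power_response[OF _ _ _ _ _ FZ]
        lattice_incompatible_power_response[OF _ _ _ _ _ FZ]) auto
  ultimately show ?thesis by blast
qed

end
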